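(* Let $k$ and $l$ be two positive integers. Then $$\mathrm{S}_2(k,l)=\begin{cases}0 & \text{if } l \text{ is odd},\\ 1 & \text{if } l \text{ is even}.\end{cases}$$
   Context: Let $k,l,m$ be positive integers. A set of integers is called $l$-sum-free modulo $m$ if it contains no elements $x_1,\ldots,x_l,y$ (not necessarily distinct) satisfying $x_1+\cdots+x_l\equiv y \pmod m$. A $k$-partition of a set $S$ is a family $S_1,\ldots,S_k$ of subsets of $S$ (possibly empty) such that every element of $S$ is contained in exactly one of them. The generalized Schur number modulo $m$, denoted $\mathrm{S}_m(k,l)$, is the largest integer $n\geq 0$ for which the set $\{1,2,\ldots,n\}$ (empty if $n=0$) admits a $k$-partition into sets that are $l$-sum-free modulo $m$. *)

theory Defs
  imports "HOL-Number_Theory.Cong"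
begin

definition sum_free_mod :: "nat \<Rightarrow> nat \<Rightarrow> int set \<Rightarrow> bool" where
  "sum_free_mod m l A \<longleftrightarrow>
     \<not> (\<exists>x :: nat \<Rightarrow> int. \<exists>y. (\<forall>i\<in>{1..l}. x i \<in> A) \<and> y \<in> A \<and>
          [(\<Sum>i=1..l. x i) = y] (mod int m))"

(* The parts are an indexed family P 1, ..., P k; several of them may be empty.
   Values of P outside {1..k} are irrelevant. *)
definition k_partition :: "nat \<Rightarrow> 'a set \<Rightarrow> (nat \<Rightarrow> 'a set) \<Rightarrow> bool" where
  "k_partition k S P \<longleftrightarrow>
     (\<forall>i\<in>{1..k}. P i \<subseteq> S) \<and> (\<forall>x\<in>S. \<exists>!i. i \<in> {1..k} \<and> x \<in> P i)"

definition has_sum_free_partition_mod :: "nat \<Rightarrow> nat \<Rightarrow> nat \<Rightarrow> nat \<Rightarrow> bool" where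
  "has_sum_free_partition_mod m k l n \<longleftrightarrow>
     (\<exists>P. k_partition k {1..int n} P \<and> (\<forall>i\<in>{1..k}. sum_free_mod m l (P i)))"

(* GREATEST picks out an actual maximum only if one exists; for m > 0 it does, by
   has_sum_free_partition_mod_0 and has_sum_free_partition_mod_less below. *)
definition schur_mod :: "nat \<Rightarrow> nat \<Rightarrow> nat \<Rightarrow> nat" where
  "schur_mod m k l = (GREATEST n. has_sum_free_partition_mod m k l n)"

lemma has_sum_free_partition_mod_0: "has_sum_free_partition_mod m k l 0"
  unfolding has_sum_free_partition_mod_def k_partition_def sum_free_mod_def
  by (intro exI[of _ "\<lambda>_. {}"]) auto

lemma has_sum_free_partition_mod_less:
  assumes "m > 0" "has_sum_free_partition_mod m k l n"
  shows "n < m"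
proof (rule ccontr)
  assume "\<not> n < m"
  with assms(1) have "int m \<in> {1..int n}" by auto
  with assms(2) obtain P i where "i \<in> {1..k}" "int m \<in> P i" "sum_free_mod m l (P i)"
    unfolding has_sum_free_partition_mod_def k_partition_def by blast
  moreover have "[(\<Sum>j=1..l. int m) = int m] (mod int m)"
    by (simp add: cong_def)
  ultimately show False
    unfolding sum_free_mod_def by (metis (no_types, lifting))
qed

end

theory Submission
  imports Defs
begin

text \<open>
  The element \<open>m\<close> is its own \<open>l\<close>-fold sum modulo \<open>m\<close>, so no part can contain it and the answer for
  modulus \<open>2\<close> is at most \<open>1\<close> (\<open>has_sum_free_partition_mod_less\<close>). Everything then depends on
  whether \<open>{1}\<close> can be partitioned. Whatever the number of parts, one of them is \<open>{1}\<close> and the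
  others are empty, and the only \<open>l\<close>-fold sum from \<open>{1}\<close> is \<open>l\<close>. Hence a sum-free partition exists
  iff \<open>l\<close> is not congruent to \<open>1\<close> modulo \<open>m\<close> (\<open>has_sum_free_partition_mod_1_iff\<close>), which for
  \<open>m = 2\<close> means that \<open>l\<close> is even.
\<close>

lemma sum_free_mod_singleton_iff:
  "sum_free_mod m l {a} \<longleftrightarrow> \<not> [int l * a = a] (mod int m)"
proof
  assume "sum_free_mod m l {a}"
  then show "\<not> [int l * a = a] (mod int m)"
    unfolding sum_free_mod_def by (auto dest!: spec[of _ "\<lambda>_. a"])
next
  assume not_cong: "\<not> [int l * a = a] (mod int m)"
  have "(\<Sum>i=1..l. x i) = int l * a" if "\<forall>i\<in>{1..l}. x i = a" for x :: "nat \<Rightarrow> int"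
    using that by simp
  with not_cong show "sum_free_mod m l {a}"
    unfolding sum_free_mod_def by auto
qed

lemma sum_free_mod_empty: "sum_free_mod m l {}"
  by (simp add: sum_free_mod_def)

lemma has_sum_free_partition_mod_1_iff:
  assumes "k \<ge> 1"
  shows "has_sum_free_partition_mod m k l 1 \<longleftrightarrow> \<not> [int l = 1] (mod int m)"
proof
  assume "has_sum_free_partition_mod m k l 1"
  then obtain P where P: "k_partition k {1} P" "\<forall>i\<in>{1..k}. sum_free_mod m l (P i)"
    unfolding has_sum_free_partition_mod_def by auto
  then obtain i where i: "i \<in> {1..k}" "1 \<in> P i" "P i \<subseteq> {1}"
    unfolding k_partition_def by blast
  then have "P i = {1}" by blast
  moreover have "sum_free_mod m l (P i)" using P(2) i(1) by blast
  ultimately have "sum_free_mod m l {1}" by simp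
  then show "\<not> [int l = 1] (mod int m)"
    by (simp add: sum_free_mod_singleton_iff)
next
  assume not_cong: "\<not> [int l = 1] (mod int m)"
  define P :: "nat \<Rightarrow> int set" where "P i = (if i = 1 then {1} else {})" for i
  have "k_partition k {1..int 1} P"
    using assms by (auto simp: k_partition_def P_def)
  moreover have "sum_free_mod m l (P i)" for i
    using not_cong by (simp add: P_def sum_free_mod_singleton_iff sum_free_mod_empty)
  ultimately show "has_sum_free_partition_mod m k l 1"
    unfolding has_sum_free_partition_mod_def by blast
qed

theorem theorem1p1:
  fixes k l :: nat
  assumes "k \<ge> 1" and "l \<ge> 1"
  shows "schur_mod 2 k l = (if odd l then 0 else 1)"
proof -
  have one_iff: "has_sum_free_partition_mod 2 k l 1 \<longleftrightarrow> even l"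
  proof -
    have "[int l = 1] (mod int 2) \<longleftrightarrow> odd l"
      by (simp add: cong_def flip: odd_iff_mod_2_eq_one)
    then show ?thesis
      using has_sum_free_partition_mod_1_iff[OF assms(1)] by simp
  qed
  have le_one: "n \<le> 1" if "has_sum_free_partition_mod 2 k l n" for n
    using has_sum_free_partition_mod_less[OF _ that] by simp
  show ?thesis
    unfolding schur_mod_def
  proof (rule Greatest_equality)
    show "has_sum_free_partition_mod 2 k l (if odd l then 0 else 1)"
      using one_iff has_sum_free_partition_mod_0 by simp
  next
    fix n assume n: "has_sum_free_partition_mod 2 k l n"
    with le_one consider "n = 0" | "n = 1" by fastforce
    then show "n \<le> (if odd l then 0 else 1)"
      using n one_iff by cases auto
  qed
qed

end
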